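(* The generating function $f_i(x,y)=\sum_{n,m\ge 0}(n,m)_i\, x^n y^m$ of the $i$th tier binomial coefficients is given by \[ f_i(x,y)= \frac{1}{i+1-x-y}\cdot\frac{\binom{i-x}{i}}{\binom{i-x-y}{i}},\quad i\ge 0. \]
   Context: The tier-$i$ binomial coefficients $(n,m)_i$ ($i\ge0$, $n,m\ge0$) are the rational numbers determined by the recurrence $(n,m)_i=\frac{(n-1,m)_i}{i+1}+\frac1{i+1}\sum_{j=0}^i(n,m-1)_j$ for $n,m>0$, with initial values $(0,m)_i=\frac1{i+1}\zeta^{\star}_{i+1}(\{1\}_m)$ and $(n,0)_i=(i+1)^{-n-1}$, where $\zeta^{\star}_n(\{1\}_k)=\sum_{n\ge\ell_1\ge\cdots\ge\ell_k\ge1}(\ell_1\cdots\ell_k)^{-1}$. (They are the rational coefficients in the expansion of $S_{n,m}^{(i)}=\frac{(-1)^{n+m}}{n!m!}\int_0^1x^i\ln^n x\ln^m(1-x)dx$ into multiple zeta values $\zeta(a+1,\{1\}_{b-1})$.) *)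

theory Defs
  imports "HOL-Computational_Algebra.Computational_Algebra"
begin

definition zeta_star_ones :: "nat \<Rightarrow> nat \<Rightarrow> rat" where
  "zeta_star_ones n k =
     (\<Sum>ls | length ls = k \<and> set ls \<subseteq> {1..n} \<and> sorted_wrt (\<ge>) ls. 1 / of_nat (prod_list ls))"

text \<open>The two initial conditions agree at \<open>n = m = 0\<close>, both giving \<open>1 / (i + 1)\<close>.\<close>

function tier_binomial :: "nat \<Rightarrow> nat \<Rightarrow> nat \<Rightarrow> rat" where
  "tier_binomial 0 m i = 1 / of_nat (i + 1) * zeta_star_ones (i + 1) m"
| "tier_binomial (Suc n) 0 i = 1 / of_nat (i + 1) ^ (Suc n + 1)"
| "tier_binomial (Suc n) (Suc m) i =
     tier_binomial n (Suc m) i / of_nat (i + 1)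
     + 1 / of_nat (i + 1) * (\<Sum>j = 0..i. tier_binomial (Suc n) m j)"
  by pat_completeness auto
termination
  by (relation "measure (\<lambda>(n, m, i). n + m)") auto

lemma tier_binomial_0_right: "tier_binomial n 0 i = 1 / of_nat (i + 1) ^ (n + 1)"
proof (cases n)
  case 0
  have "{ls :: nat list. length ls = 0 \<and> set ls \<subseteq> {1..i + 1} \<and> sorted_wrt (\<ge>) ls} = {[]}"
    by auto
  then have "zeta_star_ones (i + 1) 0 = 1"
    by (simp add: zeta_star_ones_def)
  with 0 show ?thesis by simp
qed simp

text \<open>
  Formal power series in \<open>x\<close>, \<open>y\<close> are series in \<open>x\<close> whose coefficients are series in \<open>y\<close>:
  the coefficient of \<open>x\<^sup>n y\<^sup>m\<close> in \<open>f\<close> is \<open>f $ n $ m\<close>. Quotients and generalised binomial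
  coefficients of such series are taken in the fraction field of this integral domain, into
  which the series embed by the injective map \<open>to_fract\<close>.
\<close>

type_synonym bivariate_fraction = "rat fps fps fract"

definition var_x :: bivariate_fraction where
  "var_x = to_fract fps_X"

definition var_y :: bivariate_fraction where
  "var_y = to_fract (fps_const fps_X)"

definition tier_gf :: "nat \<Rightarrow> rat fps fps" where
  "tier_gf i = Abs_fps (\<lambda>n. Abs_fps (\<lambda>m. tier_binomial n m i))"

instance fract :: ("{idom, semiring_char_0}") field_char_0
proof
  show "inj (of_nat :: nat \<Rightarrow> 'a fract)"
    by (rule injI) (simp add: of_nat_fract eq_fract)
qed

end

theory Submission
  imports Defs
begin

text \<open>
  The recurrence together with both boundary conditions amounts to the single identity
  \<open>(i + 1) f\<^sub>i = 1 + x f\<^sub>i + y (f\<^sub>0 + \<dots> + f\<^sub>i)\<close>. Hence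
  \<open>S\<^sub>i = 1 + y (f\<^sub>0 + \<dots> + f\<^sub>i\<^sub>-\<^sub>1)\<close> satisfies \<open>(i + 1 - x - y) f\<^sub>i = S\<^sub>i\<close> and
  \<open>S\<^sub>i\<^sub>+\<^sub>1 = S\<^sub>i (i + 1 - x) / (i + 1 - x - y)\<close>, which is also the recurrence of the
  quotient of binomial coefficients.
\<close>

text \<open>The head \<open>l\<close> of a weakly decreasing list is its largest entry. Splitting it
  off leaves a tail that ranges over exactly the weakly decreasing lists with entries in
  \<open>{1..l}\<close>.\<close>

lemma zeta_star_ones_Suc:
  "zeta_star_ones n (Suc k) = (\<Sum>l = 1..n. 1 / of_nat l * zeta_star_ones l k)"
proof -
  define S where "S = (\<lambda>n k. {ls :: nat list. length ls = k \<and> set ls \<subseteq> {1..n} \<and> sorted_wrt (\<ge>) ls})"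
  have fin: "finite (S n k)" for n k
    by (rule finite_subset[OF _ finite_lists_length_eq[of "{1..n}" k]]) (auto simp: S_def)
  have S_Suc: "S n (Suc k) = (\<Union>l\<in>{1..n}. Cons l ` S l k)"
  proof (intro equalityI subsetI)
    fix ls assume "ls \<in> S n (Suc k)"
    then show "ls \<in> (\<Union>l\<in>{1..n}. Cons l ` S l k)"
      by (cases ls) (auto simp: S_def subset_iff intro!: bexI[of _ "hd ls"] imageI)
  next
    fix ls assume "ls \<in> (\<Union>l\<in>{1..n}. Cons l ` S l k)"
    then show "ls \<in> S n (Suc k)"
      by (fastforce simp: S_def)
  qed
  have "zeta_star_ones n (Suc k) = (\<Sum>ls\<in>S n (Suc k). 1 / of_nat (prod_list ls))"
    by (simp add: zeta_star_ones_def S_def)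
  also have "\<dots> = (\<Sum>l = 1..n. \<Sum>ls\<in>Cons l ` S l k. 1 / of_nat (prod_list ls))"
    unfolding S_Suc by (rule sum.UNION_disjoint) (auto simp: fin)
  also have "\<dots> = (\<Sum>l = 1..n. \<Sum>ls\<in>S l k. 1 / of_nat l * (1 / of_nat (prod_list ls)))"
    by (rule sum.cong[OF refl]) (simp add: sum.reindex)
  also have "\<dots> = (\<Sum>l = 1..n. 1 / of_nat l * zeta_star_ones l k)"
    by (simp add: zeta_star_ones_def S_def sum_distrib_left)
  finally show ?thesis .
qed

text \<open>The boundary values obey the same recurrence once terms with a negative index count as
  0; only the origin needs the extra 1. This makes a coefficientwise comparison possible without
  boundary cases.\<close>

lemma tier_binomial_recurrence:
  "of_nat (i + 1) * tier_binomial n m i =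
    (if n = 0 \<and> m = 0 then 1 else 0)
    + (if n = 0 then 0 else tier_binomial (n - 1) m i)
    + (if m = 0 then 0 else \<Sum>j\<le>i. tier_binomial n (m - 1) j)"
proof -
  have nz: "(of_nat (i + 1) :: rat) \<noteq> 0"
    by (simp only: of_nat_eq_0_iff)
  show ?thesis
  proof (cases m)
    case 0
    then show ?thesis
      using nz by (cases n) (simp_all add: tier_binomial_0_right field_simps del: of_nat_Suc of_nat_add)
  next
    case m: (Suc k)
    show ?thesis
    proof (cases n)
      case 0
      have "of_nat (i + 1) * tier_binomial 0 m i = zeta_star_ones (i + 1) (Suc k)"
        using nz m by simp
      \<comment> \<open>With \<open>l = j + 1\<close>, the summand
        \<open>1 / l * zeta_star_ones l k\<close> is the initial value of tier
        \<open>j\<close>.\<close>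
      also have "\<dots> = (\<Sum>j\<le>i. tier_binomial 0 k j)"
        by (simp add: zeta_star_ones_Suc sum.atLeast_Suc_atMost_Suc_shift atMost_atLeast0
            del: sum.cl_ivl_Suc)
      finally show ?thesis
        using 0 m by simp
    next
      case (Suc l)
      then show ?thesis
        using nz m by (simp add: atMost_atLeast0 field_simps del: of_nat_Suc of_nat_add)
    qed
  qed
qed

lemma tier_gf_recurrence:
  "of_nat (i + 1) * tier_gf i =
    1 + fps_X * tier_gf i + fps_const fps_X * (\<Sum>j\<le>i. tier_gf j)"
proof (intro fps_ext)
  fix n m
  have "(of_nat (i + 1) * tier_gf i) $ n $ m = of_nat (i + 1) * tier_binomial n m i"
    by (simp add: tier_gf_def fps_of_nat[symmetric] del: of_nat_Suc of_nat_add)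
  \<comment> \<open>Multiplying by \<open>fps_X\<close> shifts the index \<open>n\<close>;
    multiplying by \<open>fps_const fps_X\<close> shifts \<open>m\<close> inside each
    coefficient.\<close>
  moreover have "(1 + fps_X * tier_gf i + fps_const fps_X * (\<Sum>j\<le>i. tier_gf j)) $ n $ m =
    (if n = 0 \<and> m = 0 then 1 else 0)
    + (if n = 0 then 0 else tier_binomial (n - 1) m i)
    + (if m = 0 then 0 else \<Sum>j\<le>i. tier_binomial n (m - 1) j)"
    by (simp add: tier_gf_def fps_sum_nth)
  ultimately show "(of_nat (i + 1) * tier_gf i) $ n $ m =
    (1 + fps_X * tier_gf i + fps_const fps_X * (\<Sum>j\<le>i. tier_gf j)) $ n $ m"
    by (simp only: tier_binomial_recurrence)
qed

lemma to_fract_of_nat: "to_fract (of_nat n) = of_nat n"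
  by (induction n) simp_all

lemma to_fract_sum: "to_fract (sum f A) = (\<Sum>a\<in>A. to_fract (f a))"
  by (induction A rule: infinite_finite_induct) simp_all

text \<open>Moving the term \<open>j = i\<close> of the sum to the left leaves only lower tiers on
  the right.\<close>

lemma tier_gf_eq:
  "(of_nat i + 1 - var_x - var_y) * to_fract (tier_gf i) =
    1 + var_y * (\<Sum>j<i. to_fract (tier_gf j))"
proof -
  have "of_nat (i + 1) * to_fract (tier_gf i) =
      1 + var_x * to_fract (tier_gf i) + var_y * (\<Sum>j\<le>i. to_fract (tier_gf j))"
    using arg_cong[OF tier_gf_recurrence[of i], of to_fract]
    unfolding to_fract_add to_fract_mult to_fract_of_nat to_fract_sum to_fract_1
    by (simp only: var_x_def var_y_def)
  then show ?thesis
    by (simp add: lessThan_Suc_atMost[symmetric] algebra_simps)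
qed

text \<open>Since \<open>to_fract\<close> is injective, it suffices that the underlying series has
  constant coefficient \<open>i + 1\<close>.\<close>

lemma nat_minus_vars_nonzero: "of_nat i + 1 - var_x - var_y \<noteq> 0"
proof
  assume "of_nat i + 1 - var_x - var_y = 0"
  then have "to_fract (of_nat (Suc i) - fps_X - fps_const fps_X :: rat fps fps) = to_fract 0"
    by (simp only: to_fract_diff to_fract_of_nat var_x_def var_y_def to_fract_0 to_fract_add to_fract_1 of_nat_Suc add.commute)
  then have "(of_nat (Suc i) - fps_X - fps_const fps_X :: rat fps fps) = 0"
    by (simp only: to_fract_eq_iff)
  then have "(of_nat (Suc i) - fps_X - fps_const fps_X :: rat fps fps) $ 0 $ 0 = 0"
    by simp
  then show False
    by (simp add: fps_of_nat[symmetric] del: of_nat_Suc)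
qed

text \<open>The absorption identity, in a form that serves the numerator with \<open>a = x\<close>
  and the denominator with \<open>a = x + y\<close>.\<close>

lemma gbinomial_shift_Suc:
  fixes a :: "'a :: field_char_0"
  shows "(of_nat (Suc k) - a) gchoose Suc k =
    (of_nat k + 1 - a) / of_nat (Suc k) * ((of_nat k - a) gchoose k)"
  using gbinomial_absorption[of k "of_nat (Suc k) - a"]
  by (simp add: field_simps del: of_nat_Suc) (simp add: algebra_simps)

lemma partial_sum_eq_gbinomial_quotient:
  "1 + var_y * (\<Sum>j<i. to_fract (tier_gf j)) =
    ((of_nat i - var_x) gchoose i) / ((of_nat i - var_x - var_y) gchoose i)"
proof (induction i)
  case 0
  show ?case by simp
next
  case (Suc i)
  define S where "S = 1 + var_y * (\<Sum>j<i. to_fract (tier_gf j))"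
  define d where "d = of_nat i + 1 - var_x - var_y"
  have d: "d \<noteq> 0"
    unfolding d_def by (rule nat_minus_vars_nonzero)
  have f: "to_fract (tier_gf i) = S / d"
    using tier_gf_eq[of i] d by (simp add: S_def d_def field_simps)
  have "1 + var_y * (\<Sum>j<Suc i. to_fract (tier_gf j)) = S + var_y * to_fract (tier_gf i)"
    by (simp add: S_def algebra_simps)
  also have "\<dots> = (of_nat i + 1 - var_x) / d * S"
  proof -
    have "of_nat i + 1 - var_x = d + var_y"
      by (simp add: d_def)
    then show ?thesis
      using d by (simp add: f field_simps)
  qed
  \<comment> \<open>Both binomials contribute a factor \<open>1 / (i + 1)\<close>, which cancels in
    the quotient.\<close>
  also have "\<dots> = ((of_nat (Suc i) - var_x) gchoose Suc i) /
      ((of_nat (Suc i) - (var_x + var_y)) gchoose Suc i)"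
    unfolding gbinomial_shift_Suc
    by (simp add: S_def Suc.IH d_def diff_diff_eq del: of_nat_Suc)
  finally show ?case
    by (simp only: diff_diff_eq)
qed

theorem theorem3p5:
  fixes i :: nat
  shows "to_fract (tier_gf i) =
    1 / (of_nat i + 1 - var_x - var_y) *
    (((of_nat i - var_x) gchoose i) / ((of_nat i - var_x - var_y) gchoose i))"
  using tier_gf_eq[of i] nat_minus_vars_nonzero[of i]
  unfolding partial_sum_eq_gbinomial_quotient
  by (metis nonzero_mult_div_cancel_left mult.left_neutral times_divide_eq_left)

end
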